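(* Let $k\ge 2$ and let $f\in(\mathbb{C}^d)^{\otimes k}$ be a symmetric tensor. If $\mathrm{Q}(f)=d$, then $\mathrm{Q}_{\mathrm{s}}(f)=d$.
   Context: A tensor $f\in(\mathbb{C}^d)^{\otimes k}$ is symmetric if its coordinates are invariant under all permutations of the $k$ indices. For $r\ge 0$ the unit tensor is $\langle r\rangle=\sum_{i=1}^r e_i^{\otimes k}\in(\mathbb{C}^r)^{\otimes k}$, with $e_1,\dots,e_r$ the standard basis. The subrank $\mathrm{Q}(f)$ is the largest $r$ such that there are linear maps $A^{(1)},\dots,A^{(k)}:\mathbb{C}^d\to\mathbb{C}^r$ with $\langle r\rangle=(A^{(1)}\otimes\cdots\otimes A^{(k)})f$. The symmetric subrank $\mathrm{Q}_{\mathrm{s}}(f)$ is the largest $r$ such that there is a single linear map $A:\mathbb{C}^d\to\mathbb{C}^r$ with $\langle r\rangle=A^{\otimes k}f$. *)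

theory Defs
  imports
    "HOL-Library.FuncSet"
    "HOL-Combinatorics.Permutations"
    "Jordan_Normal_Form.Determinant"
begin

text \<open>
  A tensor of order \<open>k\<close> over \<open>\<complex>\<^sup>d\<close> is given by its coordinates in the standard basis. A multi-index
  is a function \<open>i\<close> on the positions \<open>{..<k}\<close> with values in \<open>{..<d}\<close>. Positions and basis
  vectors are counted from 0. Multi-indices and tensors are extensional
  (\<open>undefined\<close> outside their domain), so that \<open>=\<close> between elements of
  \<open>tensor_space k d\<close> is equality of tensors.
\<close>

definition tensor_index :: "nat \<Rightarrow> nat \<Rightarrow> (nat \<Rightarrow> nat) set" where
  "tensor_index k d = ({..<k} \<rightarrow>\<^sub>E {..<d})"

definition tensor_space :: "nat \<Rightarrow> nat \<Rightarrow> ((nat \<Rightarrow> nat) \<Rightarrow> complex) set" where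
  "tensor_space k d = (tensor_index k d \<rightarrow>\<^sub>E UNIV)"

definition symmetric_tensor :: "nat \<Rightarrow> nat \<Rightarrow> ((nat \<Rightarrow> nat) \<Rightarrow> complex) \<Rightarrow> bool" where
  "symmetric_tensor k d f \<longleftrightarrow>
     (\<forall>\<pi>. \<pi> permutes {..<k} \<longrightarrow> (\<forall>i\<in>tensor_index k d. f (i \<circ> \<pi>) = f i))"

definition pure_tensor :: "nat \<Rightarrow> nat \<Rightarrow> (nat \<Rightarrow> complex vec) \<Rightarrow> ((nat \<Rightarrow> nat) \<Rightarrow> complex)" where
  "pure_tensor k d v = (\<lambda>i\<in>tensor_index k d. \<Prod>l<k. v l $ i l)"

definition unit_tensor :: "nat \<Rightarrow> nat \<Rightarrow> ((nat \<Rightarrow> nat) \<Rightarrow> complex)" where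
  "unit_tensor k r = (\<lambda>i\<in>tensor_index k r. \<Sum>m<r. pure_tensor k r (\<lambda>l. unit_vec r m) i)"

text \<open>
  A linear map \<open>\<complex>\<^sup>d \<rightarrow> \<complex>\<^sup>r\<close> is an \<open>r \<times> d\<close> matrix. The following is the action of
  \<open>A 0 \<otimes> \<dots> \<otimes> A (k - 1)\<close> on \<open>f\<close> in coordinates.
\<close>

definition tensor_map ::
  "nat \<Rightarrow> nat \<Rightarrow> nat \<Rightarrow> (nat \<Rightarrow> complex mat) \<Rightarrow> ((nat \<Rightarrow> nat) \<Rightarrow> complex) \<Rightarrow> ((nat \<Rightarrow> nat) \<Rightarrow> complex)" where
  "tensor_map k d r A f =
     (\<lambda>i\<in>tensor_index k r. \<Sum>j\<in>tensor_index k d. (\<Prod>l<k. A l $$ (i l, j l)) * f j)"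

definition restricts_to_unit :: "nat \<Rightarrow> nat \<Rightarrow> ((nat \<Rightarrow> nat) \<Rightarrow> complex) \<Rightarrow> nat \<Rightarrow> bool" where
  "restricts_to_unit k d f r \<longleftrightarrow>
     (\<exists>A. (\<forall>l<k. A l \<in> carrier_mat r d) \<and> unit_tensor k r = tensor_map k d r A f)"

definition sym_restricts_to_unit :: "nat \<Rightarrow> nat \<Rightarrow> ((nat \<Rightarrow> nat) \<Rightarrow> complex) \<Rightarrow> nat \<Rightarrow> bool" where
  "sym_restricts_to_unit k d f r \<longleftrightarrow>
     (\<exists>A \<in> carrier_mat r d. unit_tensor k r = tensor_map k d r (\<lambda>l. A) f)"

text \<open>
  \<open>Max\<close> is only meaningful on finite nonempty sets. For \<open>k \<ge> 2\<close> both
  sets below contain 0 and are bounded by \<open>d\<close> (see \<open>restricts_to_unit_sets\<close>). For \<open>k = 1\<close>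
  and \<open>f \<noteq> 0\<close> every \<open>r\<close> is admissible and there is no largest one.
\<close>

definition subrank :: "nat \<Rightarrow> nat \<Rightarrow> ((nat \<Rightarrow> nat) \<Rightarrow> complex) \<Rightarrow> nat" where
  "subrank k d f = Max {r. restricts_to_unit k d f r}"

definition symmetric_subrank :: "nat \<Rightarrow> nat \<Rightarrow> ((nat \<Rightarrow> nat) \<Rightarrow> complex) \<Rightarrow> nat" where
  "symmetric_subrank k d f = Max {r. sym_restricts_to_unit k d f r}"

lemma sym_restricts_imp_restricts:
  "sym_restricts_to_unit k d f r \<Longrightarrow> restricts_to_unit k d f r"
  unfolding sym_restricts_to_unit_def restricts_to_unit_def by fastforce

lemma sym_restricts_to_unit_0: "k \<ge> 1 \<Longrightarrow> sym_restricts_to_unit k d f 0"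
  unfolding sym_restricts_to_unit_def
proof (intro bexI)
  assume "k \<ge> 1"
  hence "0 \<in> {..<k}" by simp
  hence "tensor_index k 0 = {}"
    unfolding tensor_index_def PiE_eq_empty_iff by blast
  thus "unit_tensor k 0 = tensor_map k d 0 (\<lambda>l. 0\<^sub>m 0 d) f"
    by (auto simp: unit_tensor_def tensor_map_def)
qed auto

lemma unit_tensor_apply:
  assumes "i \<in> tensor_index k r"
  shows "unit_tensor k r i = (\<Sum>m<r. \<Prod>l<k. if i l = m then 1 else 0)"
proof -
  have "i l < r" if "l < k" for l
    using assms that by (auto simp: tensor_index_def)
  thus ?thesis
    using assms by (auto simp: unit_tensor_def pure_tensor_def intro!: sum.cong prod.cong)
qed

lemma right_inverse_dim_le:
  fixes A B :: "complex mat"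
  assumes A: "A \<in> carrier_mat r d" and B: "B \<in> carrier_mat d r" and AB: "A * B = 1\<^sub>m r"
  shows "r \<le> d"
proof (rule ccontr)
  assume "\<not> r \<le> d"
  hence dr: "d < r" by simp
  define A' where "A' = mat r r (\<lambda>(i,j). if j < d then A $$ (i,j) else 0)"
  define B' where "B' = mat r r (\<lambda>(i,j). if i < d then B $$ (i,j) else 0)"
  have car: "A' \<in> carrier_mat r r" "B' \<in> carrier_mat r r"
    by (auto simp: A'_def B'_def)
  have "A' * B' = A * B"
  proof (rule eq_matI)
    fix i j assume "i < dim_row (A * B)" "j < dim_col (A * B)"
    hence ij: "i < r" "j < r" using A B by auto
    have "(A' * B') $$ (i,j) = (\<Sum>l\<in>{0..<r}. if l < d then A $$ (i,l) * B $$ (l,j) else 0)"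
      using ij car by (auto simp: scalar_prod_def A'_def B'_def intro!: sum.cong)
    also have "\<dots> = (\<Sum>l\<in>{0..<d}. A $$ (i,l) * B $$ (l,j))"
      using dr by (intro sum.mono_neutral_cong_right) auto
    also have "\<dots> = (A * B) $$ (i,j)"
      using ij A B by (auto simp: scalar_prod_def intro!: sum.cong)
    finally show "(A' * B') $$ (i,j) = (A * B) $$ (i,j)" .
  qed (use A B car in auto)
  hence "det A' * det B' = 1"
    using car AB by (metis det_mult det_one)
  hence nz: "det A' \<noteq> 0" by auto
  have "A' *\<^sub>v unit_vec r d = 0\<^sub>v r"
  proof (rule eq_vecI)
    fix i assume "i < dim_vec (0\<^sub>v r :: complex vec)"
    thus "(A' *\<^sub>v unit_vec r d) $ i = 0\<^sub>v r $ i"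
      using dr car by (auto simp: A'_def)
  qed (use car in auto)
  moreover have "unit_vec r d \<noteq> (0\<^sub>v r :: complex vec)"
    using dr by (metis index_unit_vec(2) index_zero_vec(1) zero_neq_one)
  ultimately have "det A' = 0"
    using det_0_iff_vec_prod_zero[OF car(1)] unit_vec_carrier by blast
  with nz show False by simp
qed

lemma restricts_to_unit_le:
  assumes k: "k \<ge> 2" and res: "restricts_to_unit k d f r"
  shows "r \<le> d"
proof -
  obtain A where A: "\<And>l. l < k \<Longrightarrow> A l \<in> carrier_mat r d"
    and eq: "unit_tensor k r = tensor_map k d r A f"
    using res by (auto simp: restricts_to_unit_def)
  define G where "G = mat d r (\<lambda>(p,b). \<Sum>j\<in>{j\<in>tensor_index k d. j 0 = p}.
      (\<Prod>l\<in>{1..<k}. A l $$ (b, j l)) * f j)"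
  have fin: "finite (tensor_index k d)"
    by (auto simp: tensor_index_def intro: finite_PiE)
  have img: "(\<lambda>j. j 0) ` tensor_index k d \<subseteq> {0..<d}"
  proof (rule image_subsetI)
    fix j assume "j \<in> tensor_index k d"
    hence "j \<in> {..<k} \<rightarrow>\<^sub>E {..<d}" by (simp only: tensor_index_def)
    moreover have "0 \<in> {..<k}" using k by simp
    ultimately have "j 0 \<in> {..<d}" by (rule PiE_mem)
    thus "j 0 \<in> {0..<d}" by simp
  qed
  have A0: "A 0 \<in> carrier_mat r d" using A[of 0] k by simp
  have G: "G \<in> carrier_mat d r" unfolding G_def by simp
  have split: "{..<k} = insert 0 {1..<k}" using k by auto
  have "A 0 * G = 1\<^sub>m r"
  proof (rule eq_matI)
    fix a b assume "a < dim_row (1\<^sub>m r :: complex mat)" "b < dim_col (1\<^sub>m r :: complex mat)"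
    hence ab: "a < r" "b < r" by auto
    define i where "i = (\<lambda>l\<in>{..<k}. if l = 0 then a else b)"
    have i: "i \<in> tensor_index k r"
      using ab by (auto simp: i_def tensor_index_def)
    have i0: "i 0 = a" and il: "\<And>l. l \<in> {1..<k} \<Longrightarrow> i l = b"
      using k by (auto simp: i_def)
    have "(A 0 * G) $$ (a,b) = (\<Sum>p\<in>{0..<d}. A 0 $$ (a,p) * G $$ (p,b))"
      using ab A0 G by (simp add: scalar_prod_def)
    also have "\<dots> = (\<Sum>p\<in>{0..<d}. \<Sum>j\<in>{j\<in>tensor_index k d. j 0 = p}.
        A 0 $$ (a, j 0) * ((\<Prod>l\<in>{1..<k}. A l $$ (b, j l)) * f j))"
      using ab by (intro sum.cong refl) (auto simp: G_def sum_distrib_left)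
    also have "\<dots> = (\<Sum>j\<in>tensor_index k d. 
        A 0 $$ (a, j 0) * ((\<Prod>l\<in>{1..<k}. A l $$ (b, j l)) * f j))"
      by (rule sum.group[OF fin _ img, where h = "\<lambda>j.
        A 0 $$ (a, j 0) * ((\<Prod>l\<in>{1..<k}. A l $$ (b, j l)) * f j)"]) simp
    also have "\<dots> = (\<Sum>j\<in>tensor_index k d. (\<Prod>l<k. A l $$ (i l, j l)) * f j)"
      unfolding split using i0 il by (intro sum.cong refl) (simp add: mult.assoc)
    also have "\<dots> = unit_tensor k r i"
      using i by (simp add: eq tensor_map_def)
    also have "\<dots> = (\<Sum>m<r. (if a = m then 1 else 0) * (\<Prod>l\<in>{1..<k}. if b = m then 1 else 0))"
      unfolding unit_tensor_apply[OF i] split using i0 il by (intro sum.cong refl) simp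
    also have "\<dots> = (\<Sum>m<r. if a = m then (if a = b then 1 else 0) else 0)"
      using k by (intro sum.cong refl) (auto simp: power_0_left)
    also have "\<dots> = 1\<^sub>m r $$ (a,b)"
      using ab by simp
    finally show "(A 0 * G) $$ (a,b) = 1\<^sub>m r $$ (a,b)" .
  qed (use A0 G in simp_all)
  with A0 G show ?thesis by (rule right_inverse_dim_le)
qed

lemma restricts_to_unit_sets:
  assumes "k \<ge> 2"
  shows "0 \<in> {r. restricts_to_unit k d f r}" "{r. restricts_to_unit k d f r} \<subseteq> {..d}"
    and "0 \<in> {r. sym_restricts_to_unit k d f r}" "{r. sym_restricts_to_unit k d f r} \<subseteq> {..d}"
  using assms restricts_to_unit_le[OF assms] sym_restricts_to_unit_0[of k d f]
    sym_restricts_imp_restricts[of k d f] by auto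

end

theory Submission
  imports Defs "HOL-Computational_Algebra.Fundamental_Theorem_Algebra"
begin

text \<open>
  If \<open>Q(f) = d\<close>, the maps \<open>A l\<close> taking \<open>f\<close> to the unit tensor are square, and they are invertible
  because a vector in the left kernel of \<open>A l\<close> would also annihilate the unit tensor.

  For \<open>k \<ge> 3\<close>, apply \<open>A 0\<close> to every factor of \<open>f\<close>. The resulting symmetric tensor is the image of
  the unit tensor under invertible maps \<open>C l = A 0 (A l)\<^sup>-\<^sup>1\<close> with \<open>C 0 = 1\<close>, so its coordinate at \<open>i\<close>
  is the product of the entries \<open>C l (i l, i 0)\<close> over \<open>l \<ge> 1\<close>. Exchanging positions \<open>0\<close> and \<open>l\<close>
  relates columns \<open>i 0\<close> and \<open>i l\<close> of a third factor; as these are independent, \<open>C l\<close> is diagonal,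
  and rescaling by \<open>k\<close>-th roots gives the unit tensor.

  For \<open>k = 2\<close> the tensor is an invertible symmetric complex matrix, for which Gram-Schmidt with
  respect to the associated bilinear form produces a congruence with the identity.
\<close>

section \<open>Calculus of tensor maps\<close>

lemma finite_tensor_index [simp]: "finite (tensor_index k d)"
  by (auto simp: tensor_index_def intro: finite_PiE)

lemma tensor_index_lt: "i \<in> tensor_index k d \<Longrightarrow> l < k \<Longrightarrow> i l < d"
  by (auto simp: tensor_index_def)

lemma mult_mat_entry:
  fixes A B :: "'a :: semiring_0 mat"
  assumes "A \<in> carrier_mat m n" "B \<in> carrier_mat n p" "i < m" "j < p"
  shows "(A * B) $$ (i, j) = (\<Sum>c<n. A $$ (i, c) * B $$ (c, j))"
  using assms by (auto simp: scalar_prod_def atLeast0LessThan)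

text \<open>Distributivity: summing over all intermediate multi-indices a product with one factor
  per position is the product of the sums over single indices, which are the entries of
  \<open>A l * B l\<close>.\<close>

lemma tensor_map_comp:
  assumes A: "\<And>l. l < k \<Longrightarrow> A l \<in> carrier_mat s r"
    and B: "\<And>l. l < k \<Longrightarrow> B l \<in> carrier_mat r d"
  shows "tensor_map k r s A (tensor_map k d r B f) = tensor_map k d s (\<lambda>l. A l * B l) f"
proof
  fix i
  show "tensor_map k r s A (tensor_map k d r B f) i = tensor_map k d s (\<lambda>l. A l * B l) f i"
  proof (cases "i \<in> tensor_index k s")
    case i: True
    have "tensor_map k r s A (tensor_map k d r B f) i
        = (\<Sum>j\<in>tensor_index k r. \<Sum>p\<in>tensor_index k d.
            (\<Prod>l<k. A l $$ (i l, j l) * B l $$ (j l, p l)) * f p)"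
      using i by (auto simp: tensor_map_def sum_distrib_left prod.distrib mult.assoc intro!: sum.cong)
    also have "\<dots> = (\<Sum>p\<in>tensor_index k d. (\<Sum>j\<in>tensor_index k r.
            \<Prod>l<k. A l $$ (i l, j l) * B l $$ (j l, p l)) * f p)"
      by (subst sum.swap) (simp add: sum_distrib_right)
    also have "\<dots> = (\<Sum>p\<in>tensor_index k d. (\<Prod>l<k. (A l * B l) $$ (i l, p l)) * f p)"
    proof (intro sum.cong refl)
      fix p assume p: "p \<in> tensor_index k d"
      have "(\<Sum>j\<in>tensor_index k r. \<Prod>l<k. A l $$ (i l, j l) * B l $$ (j l, p l))
          = (\<Prod>l<k. \<Sum>c<r. A l $$ (i l, c) * B l $$ (c, p l))"
        unfolding tensor_index_def
        by (rule prod_sum_PiE[symmetric, where f = "\<lambda>l c. A l $$ (i l, c) * B l $$ (c, p l)"]) auto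
      also have "\<dots> = (\<Prod>l<k. (A l * B l) $$ (i l, p l))"
        using tensor_index_lt[OF i] tensor_index_lt[OF p]
        by (intro prod.cong refl) (simp add: mult_mat_entry[OF A B])
      finally show "(\<Sum>j\<in>tensor_index k r. \<Prod>l<k. A l $$ (i l, j l) * B l $$ (j l, p l)) * f p
          = (\<Prod>l<k. (A l * B l) $$ (i l, p l)) * f p" by simp
    qed
    finally show ?thesis using i by (simp add: tensor_map_def)
  qed (simp add: tensor_map_def)
qed

lemma tensor_map_cong:
  "(\<And>l. l < k \<Longrightarrow> A l = B l) \<Longrightarrow> tensor_map k d r A f = tensor_map k d r B f"
  unfolding tensor_map_def
  by (intro restrict_ext sum.cong prod.cong arg_cong2[where f = "(*)"] refl) auto

lemma prod_indicator:
  assumes "finite S"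
  shows "(\<Prod>l\<in>S. if P l then 1 else 0 :: 'a :: comm_semiring_1) = (if \<forall>l\<in>S. P l then 1 else 0)"
  using assms by induction auto

lemma tensor_map_one:
  assumes f: "f \<in> tensor_space k d"
  shows "tensor_map k d d (\<lambda>l. 1\<^sub>m d) f = f"
proof
  fix i
  show "tensor_map k d d (\<lambda>l. 1\<^sub>m d) f i = f i"
  proof (cases "i \<in> tensor_index k d")
    case i: True
    have "(\<Prod>l<k. (1\<^sub>m d :: complex mat) $$ (i l, j l)) = (if j = i then 1 else 0)"
      if j: "j \<in> tensor_index k d" for j
    proof -
      have "(\<Prod>l<k. (1\<^sub>m d :: complex mat) $$ (i l, j l)) = (\<Prod>l<k. if i l = j l then 1 else 0)"
        using tensor_index_lt[OF i] tensor_index_lt[OF j] by (intro prod.cong) auto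
      also have "\<dots> = (if j = i then 1 else 0)"
        using i j unfolding prod_indicator[OF finite_lessThan] tensor_index_def
        by (metis PiE_ext)
      finally show ?thesis .
    qed
    then have "tensor_map k d d (\<lambda>l. 1\<^sub>m d) f i
        = (\<Sum>j\<in>tensor_index k d. if j = i then f j else 0)"
      using i unfolding tensor_map_def restrict_apply by (auto intro!: sum.cong simp del: sum.delta)
    then show ?thesis using i by simp
  next
    case False
    then show ?thesis using f by (auto simp: tensor_map_def tensor_space_def PiE_def extensional_def)
  qed
qed

text \<open>The \<open>m\<close>-th summand of the unit tensor is sent to the tensor product of the
  \<open>m\<close>-th columns of the \<open>C l\<close>.\<close>

lemma tensor_map_unit_tensor:
  assumes i: "i \<in> tensor_index k r"
  shows "tensor_map k d r C (unit_tensor k d) i = (\<Sum>m<d. \<Prod>l<k. C l $$ (i l, m))"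
proof -
  have "tensor_map k d r C (unit_tensor k d) i
      = (\<Sum>j\<in>tensor_index k d. \<Sum>m<d. \<Prod>l<k. C l $$ (i l, j l) * (if j l = m then 1 else 0))"
    using i by (auto simp: tensor_map_def unit_tensor_apply sum_distrib_left prod.distrib intro!: sum.cong)
  also have "\<dots> = (\<Sum>m<d. \<Sum>j\<in>tensor_index k d. \<Prod>l<k. C l $$ (i l, j l) * (if j l = m then 1 else 0))"
    by (rule sum.swap)
  also have "\<dots> = (\<Sum>m<d. \<Prod>l<k. \<Sum>c<d. C l $$ (i l, c) * (if c = m then 1 else 0))"
    unfolding tensor_index_def
    by (intro sum.cong refl prod_sum_PiE[symmetric,
        where f = "\<lambda>l c. C l $$ (i l, c) * (if c = _ then 1 else 0)"]) auto
  also have "\<dots> = (\<Sum>m<d. \<Prod>l<k. C l $$ (i l, m))"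
  proof (intro sum.cong prod.cong refl)
    fix m l assume "m \<in> {..<d}"
    then show "(\<Sum>c<d. C l $$ (i l, c) * (if c = m then 1 else 0)) = C l $$ (i l, m)"
      by (simp add: if_distrib[of "\<lambda>x. _ * x"] cong: if_cong)
  qed
  finally show ?thesis .
qed

lemma tensor_index_comp:
  assumes "i \<in> tensor_index k d" "\<pi> permutes {..<k}"
  shows "i \<circ> \<pi> \<in> tensor_index k d"
  unfolding tensor_index_def
proof (rule PiE_I)
  fix l assume "l \<in> {..<k}"
  then have "\<pi> l < k" using permutes_in_image[OF assms(2)] by auto
  then show "(i \<circ> \<pi>) l \<in> {..<d}" using tensor_index_lt[OF assms(1)] by simp
next
  fix l assume "l \<notin> {..<k}"
  then show "(i \<circ> \<pi>) l = undefined"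
    using assms permutes_not_in[OF assms(2)] by (auto simp: tensor_index_def)
qed

text \<open>All positions carry the same matrix, so a permutation of the output index can be moved
  to the summation index, where the symmetry of \<open>f\<close> absorbs it.\<close>

lemma symmetric_tensor_map:
  assumes "symmetric_tensor k d f"
  shows "symmetric_tensor k r (tensor_map k d r (\<lambda>l. A) f)"
  unfolding symmetric_tensor_def
proof (intro allI impI ballI)
  fix \<pi> i assume \<pi>: "\<pi> permutes {..<k}" and i: "i \<in> tensor_index k r"
  let ?\<sigma> = "Hilbert_Choice.inv \<pi>"
  have inv: "?\<sigma> permutes {..<k}" by (rule permutes_inv[OF \<pi>])
  have inv_l: "(j \<circ> \<pi>) \<circ> ?\<sigma> = j" and inv_r: "(j \<circ> ?\<sigma>) \<circ> \<pi> = j" for j :: "nat \<Rightarrow> nat"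
    by (simp_all add: fun_eq_iff permutes_inverses[OF \<pi>])
  have "tensor_map k d r (\<lambda>l. A) f (i \<circ> \<pi>)
      = (\<Sum>j\<in>tensor_index k d. (\<Prod>l<k. A $$ (i (\<pi> l), j l)) * f j)"
    using tensor_index_comp[OF i \<pi>] by (simp add: tensor_map_def)
  also have "\<dots> = (\<Sum>j\<in>tensor_index k d. (\<Prod>l<k. A $$ (i (\<pi> l), j (\<pi> l))) * f (j \<circ> \<pi>))"
    by (rule sum.reindex_bij_witness[where i = "\<lambda>j. j \<circ> \<pi>" and j = "\<lambda>j. j \<circ> ?\<sigma>"])
      (simp_all add: inv_l inv_r tensor_index_comp[OF _ \<pi>] tensor_index_comp[OF _ inv]
        permutes_inverses[OF \<pi>])
  also have "\<dots> = (\<Sum>j\<in>tensor_index k d. (\<Prod>l<k. A $$ (i l, j l)) * f j)"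
  proof (intro sum.cong refl arg_cong2[where f = "(*)"])
    fix j assume "j \<in> tensor_index k d"
    then show "f (j \<circ> \<pi>) = f j" using assms \<pi> by (auto simp: symmetric_tensor_def)
    show "(\<Prod>l<k. A $$ (i (\<pi> l), j (\<pi> l))) = (\<Prod>l<k. A $$ (i l, j l))"
      using prod.permute[OF \<pi>, of "\<lambda>l. A $$ (i l, j l)"] by (simp add: o_def)
  qed
  finally show "tensor_map k d r (\<lambda>l. A) f (i \<circ> \<pi>) = tensor_map k d r (\<lambda>l. A) f i"
    using i by (simp add: tensor_map_def)
qed

section \<open>Invertibility of the factors\<close>

lemma det_nonzero_obtain_inverse:
  fixes A :: "'a :: field mat"
  assumes A: "A \<in> carrier_mat d d" and "det A \<noteq> 0"
  obtains B where "B \<in> carrier_mat d d" "A * B = 1\<^sub>m d" "B * A = 1\<^sub>m d"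
  using det_non_zero_imp_unit[OF assms, of undefined]
  by (auto simp: Units_def ring_mat_def)

text \<open>Contract position \<open>l\<close> with a left kernel vector \<open>v\<close> of
  \<open>A l\<close> and fix all other positions at some \<open>b\<close> with \<open>v $ b\<close>
  nonzero. The unit tensor yields \<open>v $ b\<close>, but the image of \<open>f\<close> yields 0
  because the contraction meets \<open>A l\<close>.\<close>

lemma restricts_to_unit_factor_invertible:
  assumes k: "k \<ge> 2"
    and A: "\<And>l. l < k \<Longrightarrow> A l \<in> carrier_mat d d"
    and eq: "unit_tensor k d = tensor_map k d d A f"
    and l: "l < k"
  shows "det (A l) \<noteq> 0"
proof
  assume "det (A l) = 0"
  then have "det (A l)\<^sup>T = 0" using det_transpose[OF A[OF l]] by simp
  then obtain v where v: "v \<in> carrier_vec d" "v \<noteq> 0\<^sub>v d" "(A l)\<^sup>T *\<^sub>v v = 0\<^sub>v d"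
    using det_0_iff_vec_prod_zero[of "(A l)\<^sup>T" d] A[OF l] by auto
  obtain b where b: "b < d" "v $ b \<noteq> 0"
    using v by (metis carrier_vecD eq_vecI index_zero_vec(1) index_zero_vec(2))
  define i where "i a = (\<lambda>p\<in>{..<k}. if p = l then a else b)" for a
  have i: "i a \<in> tensor_index k d" if "a < d" for a
    using that b by (auto simp: i_def tensor_index_def)
  \<comment> \<open>A position other than \<open>l\<close> exists as \<open>k \<ge> 2\<close>. There
    \<open>i a\<close> has the value \<open>b\<close>, which forces \<open>a = b\<close> for a
    nonzero coordinate of the unit tensor.\<close>
  define l' where "l' = (if l = 0 then 1 else 0 :: nat)"
  have l': "l' < k" "l' \<noteq> l" using k by (auto simp: l'_def)
  have unit: "unit_tensor k d (i a) = (if a = b then 1 else 0)" if a: "a < d" for a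
  proof -
    have "(\<Prod>p<k. if i a p = m then 1 else 0 :: complex) = (if a = m \<and> b = m then 1 else 0)" for m
      unfolding prod_indicator[OF finite_lessThan] using l l' by (auto simp: i_def)
    then show ?thesis
      unfolding unit_tensor_apply[OF i[OF a]] using b a by (cases "a = b") (auto intro!: sum.neutral)
  qed
  have col: "(\<Sum>a<d. v $ a * A l $$ (a, c)) = 0" if "c < d" for c
  proof -
    have "((A l)\<^sup>T *\<^sub>v v) $ c = (\<Sum>a<d. A l $$ (a, c) * v $ a)"
      using that A[OF l] v(1) by (auto simp: scalar_prod_def atLeast0LessThan)
    then show ?thesis using v(3) that by (simp add: mult.commute)
  qed
  have "v $ b = (\<Sum>a<d. v $ a * unit_tensor k d (i a))"
    using b by (simp add: unit if_distrib[of "\<lambda>x. _ * x"] cong: if_cong)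
  also have "\<dots> = (\<Sum>a<d. \<Sum>j\<in>tensor_index k d.
      (v $ a * A l $$ (a, j l)) * ((\<Prod>p\<in>{..<k}-{l}. A p $$ (b, j p)) * f j))"
  proof (intro sum.cong refl)
    fix a assume "a \<in> {..<d}"
    then have ia: "i a \<in> tensor_index k d" using i by simp
    \<comment> \<open>Only the factor at \<open>l\<close> depends on \<open>a\<close>, so the sum
      over \<open>a\<close> can later be moved onto it.\<close>
    have "(\<Prod>p<k. A p $$ (i a p, j p)) = A l $$ (a, j l) * (\<Prod>p\<in>{..<k}-{l}. A p $$ (b, j p))" for j
      using l unfolding prod.remove[OF finite_lessThan, of l, simplified, OF l]
      by (intro arg_cong2[where f = "(*)"] prod.cong) (auto simp: i_def)
    then show "v $ a * unit_tensor k d (i a) = (\<Sum>j\<in>tensor_index k d.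
      (v $ a * A l $$ (a, j l)) * ((\<Prod>p\<in>{..<k}-{l}. A p $$ (b, j p)) * f j))"
      using ia by (simp add: eq tensor_map_def sum_distrib_left mult.assoc)
  qed
  also have "\<dots> = (\<Sum>j\<in>tensor_index k d.
      (\<Sum>a<d. v $ a * A l $$ (a, j l)) * ((\<Prod>p\<in>{..<k}-{l}. A p $$ (b, j p)) * f j))"
    by (subst sum.swap) (simp add: sum_distrib_right)
  also have "\<dots> = 0"
    using col tensor_index_lt[OF _ l] by (intro sum.neutral) auto
  finally show False using b by simp
qed

section \<open>Order at least three\<close>

text \<open>Symmetry under exchanging positions 0 and \<open>l\<close>, with a third position
  \<open>l'\<close> left free, is a linear relation between columns \<open>a\<close> and
  \<open>b\<close> of \<open>C l'\<close>. These columns are independent, so the coefficient of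
  column \<open>a\<close> vanishes; it is \<open>C l $$ (b, a)\<close> times a factor that can be
  made nonzero.\<close>

lemma symmetric_unit_image_imp_diagonal:
  assumes k: "k \<ge> 3"
    and C: "\<And>l. l < k \<Longrightarrow> C l \<in> carrier_mat d d"
    and E: "\<And>l. l < k \<Longrightarrow> E l \<in> carrier_mat d d"
    and EC: "\<And>l. l < k \<Longrightarrow> E l * C l = 1\<^sub>m d"
    and C0: "C 0 = 1\<^sub>m d"
    and sym: "symmetric_tensor k d (tensor_map k d d C (unit_tensor k d))"
    and l: "l < k" and ab: "a < d" "b < d" "a \<noteq> b"
  shows "C l $$ (b, a) = 0"
proof (cases "l = 0")
  case True
  then show ?thesis using ab C0 by simp
next
  case l0: False
  define h where "h = tensor_map k d d C (unit_tensor k d)"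
  \<comment> \<open>The free third position, distinct from 0 and \<open>l\<close>; this is where
    \<open>k \<ge> 3\<close> enters.\<close>
  define l' where "l' = (if l = 1 then 2 else 1 :: nat)"
  have l': "l' < k" "l' \<noteq> l" "l' \<noteq> 0" using k by (auto simp: l'_def)
  have ECsum: "(\<Sum>c<d. E p $$ (x, c) * C p $$ (c, y)) = (if x = y then 1 else 0)"
    if "p < k" "x < d" "y < d" for p x y
    using mult_mat_entry[OF E[OF that(1)] C[OF that(1)] that(2,3)] EC[OF that(1)] that by simp
  have "\<exists>n<d. C p $$ (n, a) \<noteq> 0" if "p < k" for p
  proof (rule ccontr)
    assume "\<not> ?thesis"
    then have "(\<Sum>c<d. E p $$ (a, c) * C p $$ (c, a)) = 0" by (intro sum.neutral) auto
    then show False using ECsum[OF that ab(1) ab(1)] by simp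
  qed
  \<comment> \<open>For the fixed column \<open>a\<close>, \<open>n p\<close> is a row in which
    \<open>C p\<close> has a nonzero entry.\<close>
  then obtain n where n: "\<And>p. p < k \<Longrightarrow> n p < d" "\<And>p. p < k \<Longrightarrow> C p $$ (n p, a) \<noteq> 0"
    by metis
  define R where "R = {1..<k} - {l, l'}"
  have fR: "finite R" and lR: "l \<notin> R" "l' \<notin> R" by (auto simp: R_def)
  have ins: "{..<k} = insert 0 (insert l (insert l' R))" and R0: "0 \<notin> R"
    using l l0 l' k by (auto simp: R_def)
  have h: "h i = C l $$ (i l, i 0) * C l' $$ (i l', i 0) * (\<Prod>p\<in>R. C p $$ (i p, i 0))"
    if i: "i \<in> tensor_index k d" for i
  proof -
    have i0: "i 0 < d" using tensor_index_lt[OF i] k by simp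
    \<comment> \<open>The factor at position 0 is an entry of the identity, so only the summand
      \<open>m = i 0\<close> survives.\<close>
    have "h i = (\<Sum>m<d. if m = i 0 then
        C l $$ (i l, m) * C l' $$ (i l', m) * (\<Prod>p\<in>R. C p $$ (i p, m)) else 0)"
      unfolding h_def tensor_map_unit_tensor[OF i] ins
      using l0 l' fR lR R0 i0 by (intro sum.cong refl) (auto simp: C0)
    then show ?thesis using i0 by simp
  qed
  \<comment> \<open>The rows \<open>n p\<close> at the remaining positions keep the product over
    \<open>R\<close> in column \<open>a\<close> nonzero.\<close>
  define i where "i c =
    (\<lambda>p\<in>{..<k}. if p = 0 then a else if p = l then b else if p = l' then c else n p)" for c
  \<comment> \<open>The coefficients in the relation between columns \<open>a\<close> and \<open>b\<close> of \<open>C l'\<close>.\<close>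
  define \<alpha> where "\<alpha> = C l $$ (b, a) * (\<Prod>p\<in>R. C p $$ (n p, a))"
  define \<beta> where "\<beta> = C l $$ (a, b) * (\<Prod>p\<in>R. C p $$ (n p, b))"
  have swap: "C l' $$ (c, a) * \<alpha> = C l' $$ (c, b) * \<beta>" if c: "c < d" for c
  proof -
    have \<pi>: "Transposition.transpose 0 l permutes {..<k}" using l by (intro permutes_swap_id) auto
    have ic: "i c \<in> tensor_index k d" using ab c n by (auto simp: i_def tensor_index_def)
    let ?j = "i c \<circ> Transposition.transpose 0 l"
    have j: "?j \<in> tensor_index k d" by (rule tensor_index_comp[OF ic \<pi>])
    have eq: "h ?j = h (i c)" using sym ic \<pi> by (auto simp: symmetric_tensor_def h_def)
    have iv: "i c 0 = a" "i c l = b" "i c l' = c" "\<And>p. p \<in> R \<Longrightarrow> i c p = n p"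
      using l l0 l' R0 lR k by (auto simp: i_def R_def)
    have jv: "?j 0 = b" "?j l = a" "?j l' = c" "\<And>p. p \<in> R \<Longrightarrow> ?j p = n p"
      using iv l' l0 lR R0 by (auto simp: transpose_def)
    show ?thesis
      using eq unfolding h[OF ic] h[OF j] iv(1-3) jv(1-3) \<alpha>_def \<beta>_def
      using iv(4) jv(4) by (simp add: mult_ac cong: prod.cong)
  qed
  \<comment> \<open>Row \<open>a\<close> of the left inverse \<open>E l'\<close> pairs to 1 with
    column \<open>a\<close> of \<open>C l'\<close> and to 0 with column \<open>b\<close>.\<close>
  have "\<alpha> = (\<Sum>c<d. E l' $$ (a, c) * C l' $$ (c, a)) * \<alpha>"
    using ECsum[OF l'(1) ab(1) ab(1)] by simp
  also have "\<dots> = (\<Sum>c<d. E l' $$ (a, c) * C l' $$ (c, b)) * \<beta>"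
    unfolding sum_distrib_right by (intro sum.cong refl) (simp add: mult.assoc swap)
  also have "\<dots> = 0" using ECsum[OF l'(1) ab(1) ab(2)] ab by simp
  finally have "\<alpha> = 0" .
  moreover have "(\<Prod>p\<in>R. C p $$ (n p, a)) \<noteq> 0"
    using n fR by (auto simp: R_def)
  ultimately show ?thesis by (simp add: \<alpha>_def)
qed

text \<open>Diagonal maps only scale the \<open>m\<close>-th summand of the unit tensor, by the
  product of their \<open>m\<close>-th diagonal entries. A \<open>k\<close>-th root of the inverse
  of this product, applied at each of the \<open>k\<close> positions, undoes the scaling.\<close>

lemma diagonal_unit_image:
  assumes k: "k \<ge> 1"
    and C: "\<And>l. l < k \<Longrightarrow> C l \<in> carrier_mat d d"
    and diag: "\<And>l a b. l < k \<Longrightarrow> a < d \<Longrightarrow> b < d \<Longrightarrow> a \<noteq> b \<Longrightarrow> C l $$ (b, a) = 0"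
    and nz: "\<And>l a. l < k \<Longrightarrow> a < d \<Longrightarrow> C l $$ (a, a) \<noteq> 0"
  shows "\<exists>D\<in>carrier_mat d d.
    tensor_map k d d (\<lambda>l. D) (tensor_map k d d C (unit_tensor k d)) = unit_tensor k d"
proof -
  have "\<exists>y::complex. y ^ k = inverse (\<Prod>l<k. C l $$ (m, m))" for m
    using k by (intro nth_root_exists) auto
  then obtain z where z: "\<And>m. z m ^ k = inverse (\<Prod>l<k. C l $$ (m, m))" by metis
  define D where "D = mat d d (\<lambda>(i,j). if i = j then z i else 0)"
  have D: "D \<in> carrier_mat d d" by (simp add: D_def)
  have DC: "(D * C l) $$ (a, m) = (if a = m then z m * C l $$ (m, m) else 0)"
    if "l < k" "a < d" "m < d" for l a m
  proof -
    have "(D * C l) $$ (a, m) = (\<Sum>c<d. if c = a then z a * C l $$ (a, m) else 0)"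
      unfolding mult_mat_entry[OF D C[OF that(1)] that(2,3)]
      using that by (intro sum.cong) (auto simp: D_def)
    then show ?thesis using diag[of l m a] that by auto
  qed
  have "tensor_map k d d (\<lambda>l. D) (tensor_map k d d C (unit_tensor k d))
      = tensor_map k d d (\<lambda>l. D * C l) (unit_tensor k d)"
    by (rule tensor_map_comp) (use D C in auto)
  also have "\<dots> = unit_tensor k d"
  proof
    fix i
    show "tensor_map k d d (\<lambda>l. D * C l) (unit_tensor k d) i = unit_tensor k d i"
    proof (cases "i \<in> tensor_index k d")
      case i: True
      have "(\<Prod>l<k. (D * C l) $$ (i l, m)) = (\<Prod>l<k. if i l = m then 1 else 0)"
        if m: "m < d" for m
      proof (cases "\<forall>l<k. i l = m")
        case True
        have "(\<Prod>l<k. (D * C l) $$ (i l, m)) = (\<Prod>l<k. z m * C l $$ (m, m))"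
          using True m by (intro prod.cong) (auto simp: DC)
        also have "\<dots> = 1" using nz[OF _ m] by (simp add: prod.distrib z)
        finally show ?thesis using True by simp
      next
        case False
        then obtain l where l: "l < k" "i l \<noteq> m" by auto
        then have "(D * C l) $$ (i l, m) = 0" using DC m tensor_index_lt[OF i] by simp
        then have "(\<Prod>l<k. (D * C l) $$ (i l, m)) = 0" using l(1) by (intro prod_zero) auto
        then show ?thesis using l by (auto simp: prod_indicator)
      qed
      then show ?thesis
        unfolding tensor_map_unit_tensor[OF i] unit_tensor_apply[OF i] by (intro sum.cong) auto
    qed (simp add: tensor_map_def unit_tensor_def)
  qed
  finally show ?thesis using D by blast
qed

lemma symmetric_restricts_order_ge_3:
  assumes k: "k \<ge> 3" and f: "f \<in> tensor_space k d" and sym: "symmetric_tensor k d f"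
    and res: "restricts_to_unit k d f d"
  shows "sym_restricts_to_unit k d f d"
proof -
  obtain A where A: "\<And>l. l < k \<Longrightarrow> A l \<in> carrier_mat d d"
    and eq: "unit_tensor k d = tensor_map k d d A f"
    using res by (auto simp: restricts_to_unit_def)
  have "\<exists>B. B \<in> carrier_mat d d \<and> A l * B = 1\<^sub>m d \<and> B * A l = 1\<^sub>m d" if "l < k" for l
    using det_nonzero_obtain_inverse[OF A[OF that]]
      restricts_to_unit_factor_invertible[of k A d f l] k A eq that
    by (metis Suc_leD eval_nat_numeral(3))
  then obtain B where B: "\<And>l. l < k \<Longrightarrow> B l \<in> carrier_mat d d"
    and AB: "\<And>l. l < k \<Longrightarrow> A l * B l = 1\<^sub>m d" and BA: "\<And>l. l < k \<Longrightarrow> B l * A l = 1\<^sub>m d"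
    by metis
  have k0: "0 < k" using k by simp
  \<comment> \<open>\<open>B l\<close> inverts \<open>A l\<close>, so \<open>C l\<close> and
    \<open>E l\<close> are mutually inverse, and \<open>C 0\<close> is the identity.\<close>
  define C where "C l = A 0 * B l" for l
  define E where "E l = A l * B 0" for l
  have C: "C l \<in> carrier_mat d d" and E: "E l \<in> carrier_mat d d" if "l < k" for l
    using A[OF that] B[OF that] A[OF k0] B[OF k0] by (auto simp: C_def E_def)
  have EC: "E l * C l = 1\<^sub>m d" if l: "l < k" for l
  proof -
    have "E l * C l = A l * (B 0 * (A 0 * B l))"
      unfolding C_def E_def
      by (rule assoc_mult_mat[of _ d d _ d _ d]) (use A[OF l] B[OF k0] A[OF k0] B[OF l] in auto)
    also have "B 0 * (A 0 * B l) = (B 0 * A 0) * B l"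
      by (rule assoc_mult_mat[symmetric, of _ d d _ d _ d]) (use B[OF k0] A[OF k0] B[OF l] in auto)
    finally show ?thesis using BA[OF k0] AB[OF l] B[OF l] by simp
  qed
  have f_eq: "f = tensor_map k d d B (unit_tensor k d)"
  proof -
    have "tensor_map k d d B (unit_tensor k d) = tensor_map k d d (\<lambda>l. B l * A l) f"
      unfolding eq by (rule tensor_map_comp) (use A B in auto)
    also have "\<dots> = tensor_map k d d (\<lambda>l. 1\<^sub>m d) f" by (rule tensor_map_cong) (rule BA)
    finally show ?thesis using tensor_map_one[OF f] by simp
  qed
  \<comment> \<open>The left side uses one map at all positions and hence is symmetric; the right
    side is an image of the unit tensor.\<close>
  have h_eq: "tensor_map k d d (\<lambda>l. A 0) f = tensor_map k d d C (unit_tensor k d)"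
    unfolding C_def by (subst f_eq, rule tensor_map_comp) (use A[OF k0] B in auto)
  have symh: "symmetric_tensor k d (tensor_map k d d C (unit_tensor k d))"
    using symmetric_tensor_map[OF sym, of d "A 0"] h_eq by simp
  have diag: "C l $$ (b, a) = 0" if "l < k" "a < d" "b < d" "a \<noteq> b" for l a b
    by (rule symmetric_unit_image_imp_diagonal[OF k C E EC _ symh that])
      (use AB[OF k0] in \<open>simp_all add: C_def\<close>)
  \<comment> \<open>Off-diagonal entries are already 0, so a zero here would make column
    \<open>a\<close> of the invertible \<open>C l\<close> vanish.\<close>
  have "C l $$ (a, a) \<noteq> 0" if l: "l < k" and a: "a < d" for l a
  proof
    assume "C l $$ (a, a) = 0"
    then have "(\<Sum>c<d. E l $$ (a, c) * C l $$ (c, a)) = 0"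
      using diag[OF l a] by (intro sum.neutral) (metis lessThan_iff mult_zero_right)
    then show False using mult_mat_entry[OF E[OF l] C[OF l] a a] EC[OF l] a by simp
  qed
  then obtain D where D: "D \<in> carrier_mat d d"
    "tensor_map k d d (\<lambda>l. D) (tensor_map k d d C (unit_tensor k d)) = unit_tensor k d"
    using diagonal_unit_image[of k C d] C diag k0 by (metis One_nat_def Suc_leI)
  have "tensor_map k d d (\<lambda>l. D) (tensor_map k d d (\<lambda>l. A 0) f) = tensor_map k d d (\<lambda>l. D * A 0) f"
    by (rule tensor_map_comp) (use A[OF k0] D in auto)
  then have "unit_tensor k d = tensor_map k d d (\<lambda>l. D * A 0) f"
    using D(2) h_eq by simp
  then show ?thesis
    using D(1) A[OF k0] by (auto simp: sym_restricts_to_unit_def intro!: bexI[of _ "D * A 0"])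
qed

section \<open>Symmetric bilinear forms and Gram-Schmidt\<close>

lemma symmetric_matrix_bilinear_commute:
  fixes F :: "complex mat"
  assumes F: "F \<in> carrier_mat d d" "F\<^sup>T = F" and uv: "u \<in> carrier_vec d" "v \<in> carrier_vec d"
  shows "u \<bullet> (F *\<^sub>v v) = v \<bullet> (F *\<^sub>v u)"
  using transpose_vec_mult_scalar[OF F(1) uv(2) uv(1)] F uv
  by (metis comm_scalar_prod mult_mat_vec_carrier)

text \<open>Polarization: evaluating the form at a sum of two basis vectors leaves twice the mixed
  entry, and 2 is invertible.\<close>

lemma quadratic_form_zero_imp_zero:
  fixes N :: "complex mat"
  assumes N: "N \<in> carrier_mat d d" "N\<^sup>T = N"
    and q: "\<And>v. v \<in> carrier_vec d \<Longrightarrow> v \<bullet> (N *\<^sub>v v) = 0"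
  shows "N = 0\<^sub>m d d"
proof (rule eq_matI)
  fix i j assume "i < dim_row (0\<^sub>m d d :: complex mat)" "j < dim_col (0\<^sub>m d d :: complex mat)"
  then have ij: "i < d" "j < d" by auto
  let ?e = "unit_vec d :: nat \<Rightarrow> complex vec"
  have e: "?e x \<in> carrier_vec d" for x by simp
  have Ne: "N *\<^sub>v ?e x \<in> carrier_vec d" for x using N(1) by simp
  have "0 = (?e i + ?e j) \<bullet> (N *\<^sub>v (?e i + ?e j))" by (rule q[symmetric]) simp
  also have "\<dots> = (?e i + ?e j) \<bullet> (N *\<^sub>v ?e i) + (?e i + ?e j) \<bullet> (N *\<^sub>v ?e j)"
    unfolding mult_add_distrib_mat_vec[OF N(1) e e]
    by (rule scalar_prod_add_distrib[OF add_carrier_vec[OF e e] Ne Ne])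
  also have "\<dots> = ?e i \<bullet> (N *\<^sub>v ?e i) + ?e j \<bullet> (N *\<^sub>v ?e i) + (?e i \<bullet> (N *\<^sub>v ?e j) + ?e j \<bullet> (N *\<^sub>v ?e j))"
    unfolding add_scalar_prod_distrib[OF e e Ne] ..
  also have "\<dots> = 2 * (?e i \<bullet> (N *\<^sub>v ?e j))"
    using q[OF e] symmetric_matrix_bilinear_commute[OF N e e, of i j] by simp
  finally have "?e i \<bullet> (N *\<^sub>v ?e j) = 0" by simp
  then show "N $$ (i, j) = 0\<^sub>m d d $$ (i, j)"
    using ij N(1) scalar_prod_left_unit[OF Ne ij(1)] by simp
qed (use N in auto)

text \<open>Lets \<open>A * F * A\<^sup>T = 1\<^sub>m r\<close> be read as orthonormality of the
  rows of \<open>A\<close> for the form \<open>F\<close>.\<close>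

lemma congruence_entry:
  fixes A F :: "complex mat"
  assumes A: "A \<in> carrier_mat r d" and F: "F \<in> carrier_mat d d" and ij: "i < r" "j < r"
  shows "(A * F * A\<^sup>T) $$ (i, j) = row A i \<bullet> (F *\<^sub>v row A j)"
proof -
  have "A * F * A\<^sup>T = A * (F * A\<^sup>T)" by (rule assoc_mult_mat[of _ r d _ d _ r]) (use A F in auto)
  moreover have "col (F * A\<^sup>T) j = F *\<^sub>v row A j"
    using A F ij by (subst col_mult2[of _ d d _ r]) auto
  ultimately show ?thesis using A F ij by simp
qed

text \<open>One Gram-Schmidt step. The form may have isotropic vectors, so the start vector
  \<open>v\<close> must be chosen such that its projection \<open>u\<close> is not
  isotropic.\<close>

lemma extend_orthonormal_rows:
  fixes A F U :: "complex mat"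
  assumes F: "F \<in> carrier_mat d d" "F\<^sup>T = F" and U: "U \<in> carrier_mat d d" "U * F = 1\<^sub>m d"
    and A: "A \<in> carrier_mat r d" "A * F * A\<^sup>T = 1\<^sub>m r" and r: "r < d"
  shows "\<exists>A'\<in>carrier_mat (Suc r) d. A' * F * A'\<^sup>T = 1\<^sub>m (Suc r)"
proof -
  have AT: "A\<^sup>T \<in> carrier_mat d r" and AF: "A * F \<in> carrier_mat r d" and FAT: "F * A\<^sup>T \<in> carrier_mat d r"
    using A F by auto
  have AFT: "(A * F)\<^sup>T = F * A\<^sup>T" using transpose_mult[OF A(1) F(1)] F by simp
  have FATT: "(F * A\<^sup>T)\<^sup>T = A * F" using transpose_mult[OF F(1) AT] F by simp
  define M where "M = (F * A\<^sup>T) * (A * F)"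
  have M: "M \<in> carrier_mat d d" using AF FAT by (simp add: M_def)
  have MT: "M\<^sup>T = M" unfolding M_def using transpose_mult[OF FAT AF] AFT FATT by simp
  \<comment> \<open>\<open>N\<close> is the form \<open>F\<close> pulled back along the orthogonal projection \<open>v \<mapsto> v - A\<^sup>T A F v\<close> away from
    the rows of \<open>A\<close>. It is nonzero, as otherwise \<open>F = M\<close> would have rank at most \<open>r < d\<close>.\<close>
  define N where "N = F - M"
  have N: "N \<in> carrier_mat d d" unfolding N_def using F M by (intro minus_carrier_mat)
  have NT: "N\<^sup>T = N" unfolding N_def using transpose_minus[OF F(1) M] F MT by simp
  have "N \<noteq> 0\<^sub>m d d"
  proof
    assume "N = 0\<^sub>m d d"
    have "F = M"
    proof (rule eq_matI)
      fix i j assume "i < dim_row M" "j < dim_col M"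
      then have ij: "i < d" "j < d" using M by auto
      then have "N $$ (i, j) = F $$ (i, j) - M $$ (i, j)" unfolding N_def using F M by (intro index_minus_mat) auto
      then show "F $$ (i, j) = M $$ (i, j)" using \<open>N = 0\<^sub>m d d\<close> ij by simp
    qed (use F M in auto)
    \<comment> \<open>The identity of size \<open>d\<close> would factor through dimension
      \<open>r\<close>.\<close>
    then have "(U * (F * A\<^sup>T)) * (A * F) = 1\<^sub>m d"
      using U assoc_mult_mat[OF U(1) FAT AF] by (simp add: M_def)
    then have "d \<le> r" by (rule right_inverse_dim_le[rotated 2]) (use U FAT AF in auto)
    then show False using r by simp
  qed
  then obtain v where v: "v \<in> carrier_vec d" "v \<bullet> (N *\<^sub>v v) \<noteq> 0"
    using quadratic_form_zero_imp_zero[OF N NT] by blast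
  \<comment> \<open>The coefficients of \<open>v\<close> along the rows of \<open>A\<close>;
    subtracting that combination leaves the component \<open>u\<close> orthogonal to them.\<close>
  define w where "w = (A * F) *\<^sub>v v"
  have w: "w \<in> carrier_vec r" using AF v by (simp add: w_def)
  define u where "u = v - A\<^sup>T *\<^sub>v w"
  have ATw: "A\<^sup>T *\<^sub>v w \<in> carrier_vec d" using AT w by simp
  have u: "u \<in> carrier_vec d" using v ATw by (simp add: u_def)
  have Fu: "F *\<^sub>v u = N *\<^sub>v v"
  proof -
    have "F *\<^sub>v u = F *\<^sub>v v - F *\<^sub>v (A\<^sup>T *\<^sub>v w)"
      unfolding u_def by (rule mult_minus_distrib_mat_vec[OF F(1) v(1) ATw])
    also have "F *\<^sub>v (A\<^sup>T *\<^sub>v w) = M *\<^sub>v v"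
      unfolding M_def w_def using assoc_mult_mat_vec[OF F(1) AT w] assoc_mult_mat_vec[OF FAT AF v(1)]
      by (simp add: w_def)
    also have "F *\<^sub>v v - M *\<^sub>v v = N *\<^sub>v v"
      unfolding N_def by (rule minus_mult_distrib_mat_vec[symmetric, OF F(1) M v(1)])
    finally show ?thesis .
  qed
  have AFu: "A *\<^sub>v (F *\<^sub>v u) = 0\<^sub>v r"
  proof -
    have "A *\<^sub>v (F *\<^sub>v u) = (A * F) *\<^sub>v u" using assoc_mult_mat_vec[OF A(1) F(1) u] by simp
    also have "\<dots> = w - (A * F) *\<^sub>v (A\<^sup>T *\<^sub>v w)"
      unfolding u_def mult_minus_distrib_mat_vec[OF AF v(1) ATw] by (simp only: w_def)
    also have "(A * F) *\<^sub>v (A\<^sup>T *\<^sub>v w) = w"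
      using assoc_mult_mat_vec[OF AF AT w] A(2) w by simp
    finally show ?thesis using w by simp
  qed
  \<comment> \<open>As \<open>u\<close> is orthogonal to the rows of \<open>A\<close>, the
    correction term drops out and \<open>q\<close> equals the value of the form \<open>N\<close> at
    \<open>v\<close>.\<close>
  define q where "q = u \<bullet> (F *\<^sub>v u)"
  have "q = v \<bullet> (N *\<^sub>v v) - (A\<^sup>T *\<^sub>v w) \<bullet> (F *\<^sub>v u)"
    unfolding q_def Fu using minus_scalar_prod_distrib[OF v(1) ATw, of "N *\<^sub>v v"] N v
    by (simp add: u_def)
  also have "(A\<^sup>T *\<^sub>v w) \<bullet> (F *\<^sub>v u) = w \<bullet> (A *\<^sub>v (F *\<^sub>v u))"
    by (rule transpose_vec_mult_scalar[OF A(1) _ w]) (use F u in auto)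
  also have "\<dots> = 0" using AFu w by simp
  finally have q: "q \<noteq> 0" using v by simp
  \<comment> \<open>A complex square root normalizes \<open>u\<close> whatever the nonzero value of
    \<open>q\<close>.\<close>
  define x where "x = inverse (csqrt q) \<cdot>\<^sub>v u"
  have x: "x \<in> carrier_vec d" using u by (simp add: x_def)
  have Fx: "F *\<^sub>v x = inverse (csqrt q) \<cdot>\<^sub>v (F *\<^sub>v u)"
    unfolding x_def by (rule mult_mat_vec[OF F(1) u])
  have Fuc: "F *\<^sub>v u \<in> carrier_vec d" using F u by simp
  have xx: "x \<bullet> (F *\<^sub>v x) = 1"
  proof -
    have "x \<bullet> (F *\<^sub>v x) = inverse (csqrt q) * inverse (csqrt q) * q"
      unfolding Fx unfolding x_def q_def using u Fuc by simp
    also have "inverse (csqrt q) * inverse (csqrt q) = inverse ((csqrt q)\<^sup>2)"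
      by (simp add: power2_eq_square)
    finally show ?thesis using q by simp
  qed
  have Ax: "row A i \<bullet> (F *\<^sub>v x) = 0" if i: "i < r" for i
  proof -
    have "row A i \<bullet> (F *\<^sub>v u) = (A *\<^sub>v (F *\<^sub>v u)) $ i" using i A by simp
    then show ?thesis unfolding Fx using AFu i A F(1) by simp
  qed
  define A' where "A' = mat (Suc r) d (\<lambda>(i,j). if i < r then A $$ (i,j) else x $ j)"
  have A': "A' \<in> carrier_mat (Suc r) d" by (simp add: A'_def)
  have row: "row A' i = (if i < r then row A i else x)" if "i < Suc r" for i
    using that A x by (intro eq_vecI) (auto simp: A'_def)
  have rA: "row A i \<in> carrier_vec d" if "i < r" for i using A by auto
  have "A' * F * A'\<^sup>T = 1\<^sub>m (Suc r)"
  proof (rule eq_matI)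
    fix i j assume "i < dim_row (1\<^sub>m (Suc r) :: complex mat)" "j < dim_col (1\<^sub>m (Suc r) :: complex mat)"
    then have ij: "i < Suc r" "j < Suc r" by auto
    have AA: "row A i \<bullet> (F *\<^sub>v row A j) = (if i = j then 1 else 0)" if "i < r" "j < r" for i j
      using congruence_entry[OF A(1) F(1) that] A(2) that by simp
    have xA: "x \<bullet> (F *\<^sub>v row A j) = 0" if "j < r" for j
      using symmetric_matrix_bilinear_commute[OF F x rA[OF that]] Ax[OF that] by simp
    show "(A' * F * A'\<^sup>T) $$ (i, j) = 1\<^sub>m (Suc r) $$ (i, j)"
      unfolding congruence_entry[OF A' F(1) ij] row[OF ij(1)] row[OF ij(2)]
      using ij AA xA Ax xx by auto
  qed (use A' in auto)
  with A' show ?thesis by blast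
qed

text \<open>Start from the empty family of rows and extend it \<open>d\<close> times.\<close>

lemma symmetric_invertible_congruent_one:
  fixes F U :: "complex mat"
  assumes F: "F \<in> carrier_mat d d" "F\<^sup>T = F" and U: "U \<in> carrier_mat d d" "U * F = 1\<^sub>m d"
  shows "\<exists>A\<in>carrier_mat d d. A * F * A\<^sup>T = 1\<^sub>m d"
proof -
  have "r \<le> d \<Longrightarrow> \<exists>A\<in>carrier_mat r d. A * F * A\<^sup>T = 1\<^sub>m r" for r
  proof (induction r)
    case 0
    show ?case by (intro bexI[of _ "0\<^sub>m 0 d"] eq_matI) auto
  next
    case (Suc r)
    then obtain A where "A \<in> carrier_mat r d" "A * F * A\<^sup>T = 1\<^sub>m r" by auto
    then show ?case using extend_orthonormal_rows[OF F U] Suc.prems by auto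
  qed
  then show ?thesis by simp
qed

section \<open>Order two: tensors as matrices\<close>

text \<open>Restricted to \<open>{..<2}\<close> so that it lies in the extensional index set and
  \<open>pair_index_eta\<close> is an equality of functions.\<close>

definition pair_index :: "nat \<Rightarrow> nat \<Rightarrow> nat \<Rightarrow> nat" where
  "pair_index p q = (\<lambda>l\<in>{..<2}. if l = 0 then p else q)"

lemma pair_index_simps [simp]: "pair_index p q 0 = p" "pair_index p q (Suc 0) = q"
  by (auto simp: pair_index_def)

lemma pair_index_in [simp]: "p < d \<Longrightarrow> q < d \<Longrightarrow> pair_index p q \<in> tensor_index 2 d"
  by (auto simp: pair_index_def tensor_index_def)

lemma pair_index_eta: "i \<in> tensor_index 2 d \<Longrightarrow> pair_index (i 0) (i 1) = i"
  by (auto simp: pair_index_def tensor_index_def fun_eq_iff less_2_cases_iff PiE_def extensional_def)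

lemma prod_lessThan_2: "(\<Prod>l<2. g l) = g 0 * g (1 :: nat)"
  by (simp add: numeral_2_eq_2)

lemma sum_tensor_index_2:
  "(\<Sum>j\<in>tensor_index 2 d. g j) = (\<Sum>p<d. \<Sum>q<d. g (pair_index p q))"
proof -
  have "(\<Sum>j\<in>tensor_index 2 d. g j) = (\<Sum>(p,q)\<in>{..<d}\<times>{..<d}. g (pair_index p q))"
    by (rule sum.reindex_bij_witness[where i = "\<lambda>(p,q). pair_index p q" and j = "\<lambda>j. (j 0, j 1)"])
      (auto simp: pair_index_eta[simplified] tensor_index_lt)
  then show ?thesis by (simp add: sum.cartesian_product)
qed

definition tensor_mat :: "nat \<Rightarrow> ((nat \<Rightarrow> nat) \<Rightarrow> complex) \<Rightarrow> complex mat" where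
  "tensor_mat d f = mat d d (\<lambda>(p,q). f (pair_index p q))"

lemma tensor_mat_carrier [simp]: "tensor_mat d f \<in> carrier_mat d d"
  by (simp add: tensor_mat_def)

lemma tensor_mat_index: "p < d \<Longrightarrow> q < d \<Longrightarrow> tensor_mat d f $$ (p, q) = f (pair_index p q)"
  by (simp add: tensor_mat_def)

text \<open>The first map acts on the row index and the second on the column index, hence the
  transpose on the right.\<close>

lemma tensor_mat_tensor_map:
  assumes A: "A 0 \<in> carrier_mat r d" "A 1 \<in> carrier_mat r d"
  shows "tensor_mat r (tensor_map 2 d r A f) = A 0 * tensor_mat d f * (A 1)\<^sup>T"
proof (rule eq_matI)
  fix a b assume "a < dim_row (A 0 * tensor_mat d f * (A 1)\<^sup>T)" "b < dim_col (A 0 * tensor_mat d f * (A 1)\<^sup>T)"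
  then have ab: "a < r" "b < r" using A by auto
  have A1T: "(A 1)\<^sup>T \<in> carrier_mat d r" using A by simp
  have "(A 0 * tensor_mat d f * (A 1)\<^sup>T) $$ (a, b)
      = (\<Sum>q<d. \<Sum>p<d. A 0 $$ (a, p) * f (pair_index p q) * A 1 $$ (b, q))"
    unfolding mult_mat_entry[OF mult_carrier_mat[OF A(1) tensor_mat_carrier] A1T ab]
    using ab A by (intro sum.cong refl)
      (simp add: mult_mat_entry[OF A(1) tensor_mat_carrier] sum_distrib_right tensor_mat_index del: index_mult_mat(1))
  also have "\<dots> = (\<Sum>p<d. \<Sum>q<d. A 0 $$ (a, p) * f (pair_index p q) * A 1 $$ (b, q))"
    by (rule sum.swap)
  also have "\<dots> = tensor_map 2 d r A f (pair_index a b)"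
    using ab by (simp add: tensor_map_def sum_tensor_index_2 prod_lessThan_2 mult_ac)
  finally show "tensor_mat r (tensor_map 2 d r A f) $$ (a, b) = (A 0 * tensor_mat d f * (A 1)\<^sup>T) $$ (a, b)"
    using ab by (simp add: tensor_mat_def)
qed (use A in \<open>auto simp: tensor_mat_def\<close>)

lemma tensor_mat_unit: "tensor_mat d (unit_tensor 2 d) = 1\<^sub>m d"
proof (rule eq_matI)
  fix a b assume "a < dim_row (1\<^sub>m d :: complex mat)" "b < dim_col (1\<^sub>m d :: complex mat)"
  then have ab: "a < d" "b < d" by auto
  have "unit_tensor 2 d (pair_index a b) = (\<Sum>m<d. if m = a then (if b = a then 1 else 0) else 0)"
    unfolding unit_tensor_apply[OF pair_index_in[OF ab]]
    by (intro sum.cong) (auto simp: numeral_2_eq_2)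
  then show "tensor_mat d (unit_tensor 2 d) $$ (a, b) = 1\<^sub>m d $$ (a, b)"
    using ab by (auto simp: tensor_mat_def)
qed (auto simp: tensor_mat_def)

lemma tensor_mat_inj:
  assumes "f \<in> tensor_space 2 d" "g \<in> tensor_space 2 d" "tensor_mat d f = tensor_mat d g"
  shows "f = g"
proof (rule PiE_ext[of f "tensor_index 2 d" "\<lambda>_. UNIV" g])
  fix i assume i: "i \<in> tensor_index 2 d"
  have "i 0 < d" "i 1 < d" using tensor_index_lt[OF i] by auto
  then have "f (pair_index (i 0) (i 1)) = tensor_mat d f $$ (i 0, i 1)"
    "g (pair_index (i 0) (i 1)) = tensor_mat d g $$ (i 0, i 1)"
    by (simp_all add: tensor_mat_def)
  then show "f i = g i" using assms(3) pair_index_eta[OF i] by simp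
qed (use assms in \<open>auto simp: tensor_space_def\<close>)

text \<open>The two given maps serve only to show that the symmetric matrix of \<open>f\<close> is
  invertible; the single map comes from its congruence with the identity.\<close>

lemma symmetric_restricts_order_2:
  assumes sym: "symmetric_tensor 2 d f" and res: "restricts_to_unit 2 d f d"
  shows "sym_restricts_to_unit 2 d f d"
proof -
  obtain A where A: "A 0 \<in> carrier_mat d d" "A 1 \<in> carrier_mat d d"
    and eq: "unit_tensor 2 d = tensor_map 2 d d A f"
    using res unfolding restricts_to_unit_def
    by (metis one_less_numeral_iff semiring_norm(76) zero_less_numeral)
  define F where "F = tensor_mat d f"
  have F: "F \<in> carrier_mat d d" by (simp add: F_def)
  have FT: "F\<^sup>T = F"
  proof (rule eq_matI)
    fix a b assume "a < dim_row F" "b < dim_col F"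
    then have ab: "a < d" "b < d" using F by auto
    have \<pi>: "Transposition.transpose 0 1 permutes {..<2::nat}" by (intro permutes_swap_id) auto
    have "pair_index a b \<circ> Transposition.transpose 0 1 = pair_index b a"
      by (auto simp: pair_index_def fun_eq_iff transpose_def)
    then have "f (pair_index b a) = f (pair_index a b)"
      using sym \<pi> pair_index_in[OF ab] unfolding symmetric_tensor_def by metis
    then show "F\<^sup>T $$ (a, b) = F $$ (a, b)" using ab by (simp add: F_def tensor_mat_def)
  qed (use F in auto)
  have AFA: "A 0 * F * (A 1)\<^sup>T = 1\<^sub>m d"
    unfolding F_def tensor_mat_tensor_map[OF A, symmetric] eq[symmetric] by (rule tensor_mat_unit)
  have A1T: "(A 1)\<^sup>T \<in> carrier_mat d d" using A by simp
  \<comment> \<open>For square matrices a right inverse is also a left inverse; this exhibits a left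
    inverse of \<open>F\<close>.\<close>
  have "(A 1)\<^sup>T * (A 0 * F) = 1\<^sub>m d"
    by (rule mat_mult_left_right_inverse[OF _ A1T AFA]) (use A F in auto)
  then have "((A 1)\<^sup>T * A 0) * F = 1\<^sub>m d"
    using assoc_mult_mat[OF A1T A(1) F] by simp
  then obtain B where B: "B \<in> carrier_mat d d" "B * F * B\<^sup>T = 1\<^sub>m d"
    using symmetric_invertible_congruent_one[OF F FT, of "(A 1)\<^sup>T * A 0"] A by auto
  have "unit_tensor 2 d = tensor_map 2 d d (\<lambda>l. B) f"
  proof (rule tensor_mat_inj)
    show "tensor_mat d (unit_tensor 2 d) = tensor_mat d (tensor_map 2 d d (\<lambda>l. B) f)"
      using tensor_mat_tensor_map[of "\<lambda>l. B" d d f] B by (simp add: tensor_mat_unit F_def)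
  qed (auto simp: tensor_space_def unit_tensor_def tensor_map_def)
  with B(1) show ?thesis by (auto simp: sym_restricts_to_unit_def)
qed

theorem theorem2p14:
  fixes k d :: nat and f :: "(nat \<Rightarrow> nat) \<Rightarrow> complex"
  assumes "k \<ge> 2"
    and "f \<in> tensor_space k d"
    and "symmetric_tensor k d f"
    and "subrank k d f = d"
  shows "symmetric_subrank k d f = d"
proof -
  note sets = restricts_to_unit_sets[OF assms(1), of d f]
  have "finite {r. restricts_to_unit k d f r}" by (rule finite_subset[OF sets(2)]) simp
  moreover have "{r. restricts_to_unit k d f r} \<noteq> {}"
    using sets(1) by (rule ex_in_conv[THEN iffD1, OF exI])
  \<comment> \<open>The maximum is attained, so \<open>d\<close> itself is admissible for
    \<open>f\<close>.\<close>
  ultimately have "Max {r. restricts_to_unit k d f r} \<in> {r. restricts_to_unit k d f r}"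
    by (rule Max_in)
  then have res: "restricts_to_unit k d f d"
    using assms(4) by (simp add: subrank_def)
  have "sym_restricts_to_unit k d f d"
  proof (cases "k = 2")
    case True
    then show ?thesis using symmetric_restricts_order_2 assms(3) res by simp
  next
    case False
    then show ?thesis using symmetric_restricts_order_ge_3 assms(1,2,3) res by simp
  qed
  moreover have "finite {r. sym_restricts_to_unit k d f r}" by (rule finite_subset[OF sets(4)]) simp
  \<comment> \<open>Admissible values are bounded by \<open>d\<close>, so attaining \<open>d\<close>
    with a single map fixes the maximum.\<close>
  ultimately show ?thesis
    using sets(4) unfolding symmetric_subrank_def by (intro Max_eqI) auto
qed

end
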